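(* Suppose $\frac{\bar{\beta}}{\underline{\lambda}}\frac{1}{\sigma} < \frac{1}{\bar{\lambda}}-L-\frac{1}{\sigma}\frac{\bar{\beta}}{\underline{\lambda}}$. Let $\{x^k\}_{k\in\mathbb{N}}$ be a sequence generated from $x^0$ by the algorithm iBPG. Then $\min_{1\le k\le K}\|x^k-x^{k-1}\|^2$ converges with a sublinear rate $\mathcal{O}(1/K)$; that is, there is a constant $C\ge 0$, independent of $K$, such that for all $K\ge 1$, $$\min_{1\le k\le K}\|x^k-x^{k-1}\|^2\le\frac{C}{K}.$$
   Context: Setting. Let $f,g:\mathbb{R}^d\to(-\infty,+\infty]$, $\Psi:=f+g$, and $L>0$. Standing assumptions: (A-i) $h:\mathbb{R}^d\to(-\infty,+\infty]$ is a kernel generating distance associated with $S=\mathbb{R}^d$, i.e. $h$ is proper, lower semicontinuous and convex, $\text{dom}\,h\subset\overline{S}$, $\text{dom}\,\partial h=S$, and $h$ is $C^1$ on $\text{int}\,\text{dom}\,h = S=\mathbb{R}^d$. Its Bregman distance is $D_h(x,y):=h(x)-h(y)-\langle\nabla h(y),x-y\rangle$. (A-ii) $f$ is $C^1$, $\text{dom}\,h\subset\text{dom}\,f$, and $(f,h)$ is $L$-smooth adaptable on $S=\mathbb{R}^d$, i.e. $Lh-f$ and $Lh+f$ are convex on $S$. ($f$ and $g$ need not be convex.) (A-iii) $g$ is proper and lower semicontinuous. (A-iv) $\inf\{\Psi(u):u\in\mathbb{R}^d\}>-\infty$. (B) $\Psi$ is supercoercive: $\lim_{\|u\|\to\infty}\Psi(u)/\|u\|=\infty$.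 (C) $h$ is $\sigma$-strongly convex on $\mathbb{R}^d$, $\sigma>0$. Algorithm iBPG. Given $x^0=x^{-1}\in\text{int}\,\text{dom}\,h$ and parameters $0<\lambda_k\le 1/L$, $0\le\beta_k<1$ for $k\in\mathbb{N}=\{0,1,2,\dots\}$, for $k=0,1,2,\dots$ choose $$x^{k+1}\in\arg\min_{x\in\mathbb{R}^d}\left\{\lambda_k g(x)+\left\langle x,\lambda_k\nabla f(x^k)-\beta_k(x^k-x^{k-1})\right\rangle+D_h(x,x^k)\right\}.$$ Notation. $\bar{\beta}:=\sup_{k\in\mathbb{N}}\beta_k$, $\bar{\lambda}:=\sup_{k\in\mathbb{N}}\lambda_k$, $\underline{\lambda}:=\inf_{k\in\mathbb{N}}\lambda_k$, and it is assumed throughout that $\underline{\lambda}>0$. *)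

theory Defs
  imports "HOL-Analysis.Analysis"
begin

definition effective_domain :: "('a \<Rightarrow> ereal) \<Rightarrow> 'a set" where
  "effective_domain F = {x. F x < \<infinity>}"

definition proper_fun :: "('a \<Rightarrow> ereal) \<Rightarrow> bool" where
  "proper_fun F \<longleftrightarrow> (\<forall>x. F x \<noteq> -\<infinity>) \<and> effective_domain F \<noteq> {}"

definition lower_semicontinuous :: "('a::topological_space \<Rightarrow> ereal) \<Rightarrow> bool" where
  "lower_semicontinuous F \<longleftrightarrow> (\<forall>x. F x \<le> Liminf (at x) F)"

text \<open>
  The library's \<open>convex_on\<close> is restricted to real-valued functions. The inequality below is
  the usual one for functions that do not take the value \<open>-\<infinity>\<close> on \<open>S\<close>.
\<close>

definition ereal_convex_on :: "'a::real_vector set \<Rightarrow> ('a \<Rightarrow> ereal) \<Rightarrow> bool" where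
  "ereal_convex_on S F \<longleftrightarrow> convex S \<and>
     (\<forall>x\<in>S. \<forall>y\<in>S. \<forall>t::real. 0 < t \<and> t < 1 \<longrightarrow>
        F ((1 - t) *\<^sub>R x + t *\<^sub>R y) \<le> ereal (1 - t) * F x + ereal t * F y)"

definition strongly_convex_on :: "'a::real_inner set \<Rightarrow> real \<Rightarrow> ('a \<Rightarrow> ereal) \<Rightarrow> bool" where
  "strongly_convex_on S \<sigma> F \<longleftrightarrow> ereal_convex_on S (\<lambda>x. F x - ereal (\<sigma> / 2 * (norm x)\<^sup>2))"

definition subdifferential :: "('a::real_inner \<Rightarrow> ereal) \<Rightarrow> 'a \<Rightarrow> 'a set" where
  "subdifferential F x =
     {v. x \<in> effective_domain F \<and> (\<forall>y. F x + ereal (v \<bullet> (y - x)) \<le> F y)}"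

text \<open>
  Differentiability is expressed through \<open>real_of_ereal\<close>, which sends infinite values to
  \<open>0\<close>; hence the finiteness clause in \<open>C1_on\<close>, which is only used for open sets.
\<close>

definition grad :: "('a::real_inner \<Rightarrow> ereal) \<Rightarrow> 'a \<Rightarrow> 'a" where
  "grad F x = (THE D. GDERIV (\<lambda>y. real_of_ereal (F y)) x :> D)"

definition C1_on :: "'a::real_inner set \<Rightarrow> ('a \<Rightarrow> ereal) \<Rightarrow> bool" where
  "C1_on S F \<longleftrightarrow> (\<forall>x\<in>S. \<bar>F x\<bar> \<noteq> \<infinity>) \<and>
     (\<forall>x\<in>S. \<exists>D. GDERIV (\<lambda>y. real_of_ereal (F y)) x :> D) \<and>
     continuous_on S (grad F)"

definition kernel_generating_distance ::
    "'a::real_inner set \<Rightarrow> ('a \<Rightarrow> ereal) \<Rightarrow> bool" where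
  "kernel_generating_distance S h \<longleftrightarrow>
     proper_fun h \<and> lower_semicontinuous h \<and> ereal_convex_on UNIV h \<and>
     effective_domain h \<subseteq> closure S \<and>
     {x. subdifferential h x \<noteq> {}} = S \<and>
     interior (effective_domain h) = S \<and>
     C1_on (interior (effective_domain h)) h"

definition bregman :: "('a::real_inner \<Rightarrow> ereal) \<Rightarrow> 'a \<Rightarrow> 'a \<Rightarrow> ereal" where
  "bregman h x y = h x - h y - ereal (grad h y \<bullet> (x - y))"

definition smooth_adaptable ::
    "real \<Rightarrow> 'a::real_vector set \<Rightarrow> ('a \<Rightarrow> ereal) \<Rightarrow> ('a \<Rightarrow> ereal) \<Rightarrow> bool" where
  "smooth_adaptable L S f h \<longleftrightarrow>
     ereal_convex_on S (\<lambda>x. ereal L * h x - f x) \<and>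
     ereal_convex_on S (\<lambda>x. ereal L * h x + f x)"

definition supercoercive :: "('a::real_normed_vector \<Rightarrow> ereal) \<Rightarrow> bool" where
  "supercoercive F \<longleftrightarrow> ((\<lambda>u. F u / ereal (norm u)) \<longlongrightarrow> \<infinity>) at_infinity"

text \<open>
  The convention \<open>x\<^sup>-\<^sup>1 = x\<^sup>0\<close> is captured by truncated subtraction:
  \<open>x (k - 1) = x 0\<close> for \<open>k = 0\<close>.
\<close>

definition iBPG ::
    "('a::real_inner \<Rightarrow> ereal) \<Rightarrow> ('a \<Rightarrow> ereal) \<Rightarrow> ('a \<Rightarrow> ereal) \<Rightarrow>
     (nat \<Rightarrow> real) \<Rightarrow> (nat \<Rightarrow> real) \<Rightarrow> (nat \<Rightarrow> 'a) \<Rightarrow> bool" where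
  "iBPG f g h lam \<beta> x \<longleftrightarrow>
     x 0 \<in> interior (effective_domain h) \<and>
     (\<forall>k. is_arg_min
            (\<lambda>u. ereal (lam k) * g u
                 + ereal (u \<bullet> (lam k *\<^sub>R grad f (x k) - \<beta> k *\<^sub>R (x k - x (k - 1))))
                 + bregman h u (x k))
            (\<lambda>_. True) (x (k + 1)))"

end

theory Submission
  imports Defs
begin

text \<open>
  Comparing the minimiser \<open>x (k + 1)\<close> with the candidate \<open>x k\<close>, and using that \<open>L h - f\<close> lies
  above its tangents, bounds the decrease of \<open>\<Psi> = f + g\<close> by a multiple of the Bregman distance,
  up to the inertial term; the latter is absorbed by Young's inequality into the Lyapunov function
  \<open>\<Psi> (x k) + \<beta>sup / (2 \<lambda>inf) * norm (x k - x (k - 1))^2\<close>. The objective may be infinite at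
  \<open>x 0\<close>, so the telescoping starts at \<open>k = 1\<close> and the first step is added to the constant.
\<close>

text \<open>The definite description in \<open>grad\<close> needs uniqueness: Frechet derivatives
  are unique, and a vector is determined by its inner products with all others.\<close>

lemma grad_GDERIV:
  assumes "C1_on S F" "x \<in> S"
  shows "GDERIV (\<lambda>y. real_of_ereal (F y)) x :> grad F x"
proof -
  obtain D where D: "GDERIV (\<lambda>y. real_of_ereal (F y)) x :> D"
    using assms unfolding C1_on_def by blast
  have "D' = D" if "GDERIV (\<lambda>y. real_of_ereal (F y)) x :> D'" for D'
  proof -
    have "(\<lambda>h. h \<bullet> D') = (\<lambda>h. h \<bullet> D)"
      using has_derivative_unique[of "\<lambda>y. real_of_ereal (F y)"] that D unfolding gderiv_def by blast
    then show ?thesis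
      by (metis inner_commute vector_eq_ldot)
  qed
  then show ?thesis
    unfolding grad_def using D by (metis (mono_tags, lifting) theI')
qed

text \<open>Restricting \<open>F\<close> to the line through \<open>x\<close> and \<open>y\<close>
  reduces this to the tangent inequality in one variable, taken at 0 and evaluated at 1.\<close>

lemma GDERIV_convex_above_tangent:
  fixes F :: "'a::real_inner \<Rightarrow> real"
  assumes conv: "convex_on UNIV F" and D: "GDERIV F x :> D"
  shows "F x + D \<bullet> (y - x) \<le> F y"
proof -
  define \<phi> where "\<phi> t = F (x + t *\<^sub>R (y - x))" for t
  have "convex_on UNIV \<phi>"
  proof (rule convex_onI)
    fix t a b :: real assume t: "0 < t" "t < 1"
    have "x + ((1 - t) *\<^sub>R a + t *\<^sub>R b) *\<^sub>R (y - x)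
        = (1 - t) *\<^sub>R (x + a *\<^sub>R (y - x)) + t *\<^sub>R (x + b *\<^sub>R (y - x))"
      by (simp add: algebra_simps)
    then show "\<phi> ((1 - t) *\<^sub>R a + t *\<^sub>R b) \<le> (1 - t) * \<phi> a + t * \<phi> b"
      unfolding \<phi>_def using convex_onD[OF conv, of t] t by auto
  qed simp
  moreover have "(\<phi> has_real_derivative D \<bullet> (y - x)) (at 0 within UNIV)"
  proof -
    have "((\<lambda>t. x + t *\<^sub>R (y - x)) has_derivative (\<lambda>t. t *\<^sub>R (y - x))) (at 0)"
      by (auto intro!: derivative_eq_intros)
    from has_derivative_compose[OF this, of F "\<lambda>h. h \<bullet> D"] D
    have "(\<phi> has_derivative (\<lambda>t. (t *\<^sub>R (y - x)) \<bullet> D)) (at 0)"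
      by (simp add: \<phi>_def[abs_def] gderiv_def)
    then show ?thesis
      by (simp add: has_field_derivative_def inner_commute mult.commute mult_commute_abs)
  qed
  ultimately have "\<phi> 1 - \<phi> 0 \<ge> (D \<bullet> (y - x)) * (1 - 0)"
    by (intro convex_on_imp_above_tangent[where A = UNIV]) auto
  then show ?thesis
    by (simp add: \<phi>_def)
qed

lemma ereal_convex_on_imp_convex_on:
  assumes "ereal_convex_on S F" "\<And>u. u \<in> S \<Longrightarrow> F u = ereal (F' u)"
  shows "convex_on S F'"
proof (rule convex_onI)
  show S: "convex S" using assms by (simp add: ereal_convex_on_def)
  fix t :: real and a b assume t: "0 < t" "t < 1" and ab: "a \<in> S" "b \<in> S"
  then have "(1 - t) *\<^sub>R a + t *\<^sub>R b \<in> S"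
    using convexD_alt[OF S ab, of t] by simp
  moreover have "F ((1 - t) *\<^sub>R a + t *\<^sub>R b) \<le> ereal (1 - t) * F a + ereal t * F b"
    using assms(1) t ab by (auto simp: ereal_convex_on_def)
  ultimately show "F' ((1 - t) *\<^sub>R a + t *\<^sub>R b) \<le> (1 - t) * F' a + t * F' b"
    using assms(2) ab by simp
qed

text \<open>Summing the decrease from \<open>m\<close> to \<open>n\<close> telescopes, and
  \<open>l\<close> bounds what is left of \<open>V\<close>. The start \<open>m\<close> is free
  because the Lyapunov decrease holds only from index 1 on.\<close>

lemma telescoped_sum_le:
  fixes V a :: "nat \<Rightarrow> real"
  assumes "c > 0" and decr: "\<And>k. k \<ge> m \<Longrightarrow> V (Suc k) + c * a (Suc k) \<le> V k"
    and low: "\<And>k. k \<ge> m \<Longrightarrow> l \<le> V k" and "m \<le> n"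
  shows "(\<Sum>k=Suc m..n. a k) \<le> (V m - l) / c"
proof -
  have "V n + c * (\<Sum>k=Suc m..n. a k) \<le> V m"
    using \<open>m \<le> n\<close>
  proof (induction n rule: dec_induct)
    case (step n)
    then show ?case using decr[of n] by (simp add: distrib_left)
  qed simp
  with low[OF \<open>m \<le> n\<close>] have "c * (\<Sum>k=Suc m..n. a k) \<le> V m - l" by linarith
  then show ?thesis using \<open>c > 0\<close> by (simp add: field_simps)
qed

text \<open>A minimum never exceeds the average.\<close>

lemma Min_le_of_sum_le:
  fixes a :: "nat \<Rightarrow> real"
  assumes "(\<Sum>k=1..K. a k) \<le> C" "K \<ge> 1"
  shows "(MIN k\<in>{1..K}. a k) \<le> C / real K"
proof -
  have "real (card {1..K}) * (MIN k\<in>{1..K}. a k) \<le> (\<Sum>k=1..K. a k)"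
    by (rule sum_bounded_below) auto
  with assms show ?thesis
    by (simp add: field_simps)
qed

theorem corollary2:
  fixes f g h :: "real ^ 'd \<Rightarrow> ereal"
    and L \<sigma> :: real
    and lam \<beta> :: "nat \<Rightarrow> real"
    and x :: "nat \<Rightarrow> real ^ 'd"
  assumes "L > 0"
    and h_kernel: "kernel_generating_distance UNIV h"
    and f_not_MInf: "\<And>u. f u \<noteq> -\<infinity>"
    and f_C1: "C1_on UNIV f"
    and dom_h_f: "effective_domain h \<subseteq> effective_domain f"
    and smad: "smooth_adaptable L UNIV f h"
    and g_proper: "proper_fun g"
    and g_lsc: "lower_semicontinuous g"
    and bdd: "(INF u. f u + g u) > -\<infinity>"
    and coercive: "supercoercive (\<lambda>u. f u + g u)"
    and "\<sigma> > 0"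
    and h_strong: "strongly_convex_on UNIV \<sigma> h"
    and step: "\<And>k. 0 < lam k \<and> lam k \<le> 1 / L"
    and inertia: "\<And>k. 0 \<le> \<beta> k \<and> \<beta> k < 1"
    and inf_pos: "(INF k. lam k) > 0"
    and cond: "(SUP k. \<beta> k) / (INF k. lam k) * (1 / \<sigma>)
      < 1 / (SUP k. lam k) - L - 1 / \<sigma> * ((SUP k. \<beta> k) / (INF k. lam k))"
    and gen: "iBPG f g h lam \<beta> x"
  shows "\<exists>C\<ge>0. \<forall>K\<ge>1. (MIN k\<in>{1..K}. (norm (x k - x (k - 1)))\<^sup>2) \<le> C / real K"
proof -
  define F where "F u = real_of_ereal (f u)" for u
  define H where "H u = real_of_ereal (h u)" for u
  define G where "G u = real_of_ereal (g u)" for u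
  define \<Psi> where "\<Psi> u = F u + G u" for u
  have h_C1: "C1_on UNIV h"
    using h_kernel by (auto simp: kernel_generating_distance_def)
  \<comment> \<open>\<open>C1_on UNIV\<close> forces finite values, so \<open>F\<close> and
    \<open>H\<close> carry the same information as \<open>f\<close> and \<open>h\<close>. In
    contrast, \<open>G\<close> agrees with \<open>g\<close> only where \<open>g\<close> is
    finite.\<close>
  have f_eq: "f u = ereal (F u)" and h_eq: "h u = ereal (H u)" for u
    using f_C1 h_C1 by (auto simp: C1_on_def F_def H_def ereal_real)
  have gF: "GDERIV F u :> grad f u" and gH: "GDERIV H u :> grad h u" for u
    using grad_GDERIV[OF f_C1, of u] grad_GDERIV[OF h_C1, of u] by (simp_all add: F_def[abs_def] H_def[abs_def])
  define D where "D u v = H u - H v - grad h v \<bullet> (u - v)" for u v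
  have breg: "bregman h u v = ereal (D u v)" for u v
    by (simp add: bregman_def D_def h_eq)

  \<comment> \<open>Tangent inequality for \<open>H\<close> minus the quadratic; the quadratic terms
    complete to the square of \<open>norm (u - v)\<close>.\<close>
  have D_lower: "\<sigma> / 2 * (norm (u - v))\<^sup>2 \<le> D u v" for u v
  proof -
    have conv: "convex_on UNIV (\<lambda>u. H u - \<sigma> / 2 * (u \<bullet> u))"
      by (rule ereal_convex_on_imp_convex_on[OF h_strong[unfolded strongly_convex_on_def]])
        (simp add: h_eq power2_norm_eq_inner)
    have "GDERIV (\<lambda>u. H u - \<sigma> / 2 * (u \<bullet> u)) v :> grad h v - \<sigma> *\<^sub>R v"
      using gH[of v] unfolding gderiv_def
      by (auto intro!: derivative_eq_intros simp: algebra_simps inner_commute)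
    from GDERIV_convex_above_tangent[OF conv this, of u] show ?thesis
      by (simp add: D_def power2_norm_eq_inner algebra_simps inner_commute)
  qed

  have f_upper: "F u \<le> F v + grad f v \<bullet> (u - v) + L * D u v" for u v
  proof -
    have "ereal_convex_on UNIV (\<lambda>x. ereal L * h x - f x)"
      using smad by (simp add: smooth_adaptable_def)
    then have conv: "convex_on UNIV (\<lambda>u. L * H u - F u)"
      by (rule ereal_convex_on_imp_convex_on) (simp add: h_eq f_eq)
    have "GDERIV (\<lambda>u. L * H u - F u) v :> L *\<^sub>R grad h v - grad f v"
      using gH[of v] gF[of v] unfolding gderiv_def
      by (auto intro!: derivative_eq_intros simp: algebra_simps)
    from GDERIV_convex_above_tangent[OF conv this, of u] show ?thesis
      by (simp add: D_def algebra_simps)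
  qed

  define w where "w k = lam k *\<^sub>R grad f (x k) - \<beta> k *\<^sub>R (x k - x (k - 1))" for k
  have opt: "ereal (lam k) * g (x (Suc k)) + ereal (x (Suc k) \<bullet> w k + D (x (Suc k)) (x k))
      \<le> ereal (lam k) * g u + ereal (u \<bullet> w k + D u (x k))" for k u
  proof -
    have "is_arg_min
            (\<lambda>u. ereal (lam k) * g u + ereal (u \<bullet> w k) + bregman h u (x k))
            (\<lambda>_. True) (x (k + 1))"
      using gen unfolding iBPG_def w_def by blast
    then show ?thesis
      by (simp add: is_arg_min_def breg not_less add.assoc)
  qed
  have g_not_MInf: "g u \<noteq> -\<infinity>" for u
    using g_proper by (simp add: proper_fun_def)
  \<comment> \<open>For positive index the iterate minimises an objective that is finite somewhere,
    since \<open>g\<close> is proper. Nothing of the kind is known about \<open>x 0\<close>.\<close>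
  have g_eq: "g (x k) = ereal (G (x k))" if "k \<ge> 1" for k
  proof -
    obtain j where j: "k = Suc j" using \<open>k \<ge> 1\<close> by (cases k) auto
    obtain u where "g u < \<infinity>"
      using g_proper by (auto simp: proper_fun_def effective_domain_def)
    then obtain r where "g u = ereal r"
      using g_not_MInf[of u] by (cases "g u") auto
    with opt[of j u] step[of j] have "g (x k) \<noteq> \<infinity>"
      unfolding j by auto
    then show ?thesis
      using g_not_MInf[of "x k"] by (cases "g (x k)") (auto simp: G_def)
  qed

  obtain l where l: "\<And>k. k \<ge> 1 \<Longrightarrow> l \<le> \<Psi> (x k)"
  proof -
    have le: "(INF u. f u + g u) \<le> ereal (\<Psi> (x k))" if "k \<ge> 1" for k
      using INF_lower[of "x k" UNIV "\<lambda>u. f u + g u"] by (simp add: f_eq g_eq[OF that] \<Psi>_def)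
    \<comment> \<open>The infimum is a real number: \<open>bdd\<close> excludes one infinite value,
      the finite value at \<open>x 1\<close> the other.\<close>
    with bdd le[of 1] obtain r where "(INF u. f u + g u) = ereal r"
      by (cases "INF u. f u + g u") auto
    with le show thesis by (intro that[of r]) simp
  qed

  define lsup where "lsup = (SUP k. lam k)"
  define linf where "linf = (INF k. lam k)"
  define bsup where "bsup = (SUP k. \<beta> k)"
  \<comment> \<open>Real suprema and infima are informative only for bounded families; the bounds
    \<open>1 / L\<close>, 0 and 1 come from \<open>step\<close> and \<open>inertia\<close>.\<close>
  have lam_le: "lam k \<le> lsup" for k
    unfolding lsup_def using step by (intro cSUP_upper bdd_aboveI2) auto
  have linf_le: "linf \<le> lam k" for k
    unfolding linf_def using step by (intro cINF_lower bdd_belowI2[of _ 0]) (auto intro: less_imp_le)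
  have \<beta>_le: "\<beta> k \<le> bsup" for k
    unfolding bsup_def using inertia by (intro cSUP_upper bdd_aboveI2[of _ _ 1]) (auto intro: less_imp_le)
  have linf_pos: "linf > 0" using inf_pos by (simp add: linf_def)
  define B where "B = bsup / linf"
  define M where "M = 1 / lsup - L"
  define a where "a k = (norm (x k - x (k - 1)))\<^sup>2" for k
  have ratio: "\<beta> k / lam k \<le> B" and ratio_nonneg: "0 \<le> \<beta> k / lam k" for k
    unfolding B_def using \<beta>_le[of k] linf_le[of k] linf_pos inertia[of k] step[of k]
    by (auto intro!: frac_le order.trans[of 0 "\<beta> k" bsup])
  have B_nonneg: "B \<ge> 0" using ratio ratio_nonneg order.trans by blast
  have M_le: "M \<le> 1 / lam k - L" for k
    unfolding M_def using lam_le[of k] step[of k] by (simp add: frac_le)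
  have "B * (1 / \<sigma>) < M - 1 / \<sigma> * B"
    using cond by (simp add: B_def M_def lsup_def linf_def bsup_def)
  \<comment> \<open>This is \<open>cond\<close> multiplied by \<sigma>. Half of this gap becomes the
    decrease rate \<open>c\<close>.\<close>
  then have gap: "M * \<sigma> - 2 * B > 0"
    using \<open>\<sigma> > 0\<close> by (simp add: field_simps)
  then have M_pos: "M > 0"
    using B_nonneg \<open>\<sigma> > 0\<close> by (smt (verit) mult_nonpos_nonneg)

  \<comment> \<open>Young's inequality costs \<open>B / 2\<close> times
    \<open>a (Suc k) + a k\<close>, and the Bregman term gains
    \<open>M * \<sigma> / 2 * a (Suc k)\<close>. Adding \<open>B / 2 * a (Suc k)\<close> to both
    sides leaves the stated coefficients.\<close>
  have descent: "\<Psi> (x (Suc k)) + B / 2 * a (Suc k) + (M * \<sigma> - 2 * B) / 2 * a (Suc k)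
      \<le> \<Psi> (x k) + B / 2 * a k" if k: "k \<ge> 1" for k
  proof -
    let ?p = "x (Suc k) - x k" and ?q = "x k - x (k - 1)"
    let ?D = "D (x (Suc k)) (x k)"
    have pos: "lam k > 0" using step by blast
    have D0: "D u u = 0" for u by (simp add: D_def)
    \<comment> \<open>The competitor \<open>x k\<close> has zero Bregman distance to itself; its
      value under \<open>g\<close> is finite because \<open>k \<ge> 1\<close>.\<close>
    have "lam k * G (x (Suc k)) + ?p \<bullet> w k + ?D \<le> lam k * G (x k)"
      using opt[of k "x k"] g_eq[OF k] g_eq[of "Suc k"] by (simp add: D0 inner_diff_left)
    then have "lam k * G (x (Suc k)) + lam k * (grad f (x k) \<bullet> ?p) - \<beta> k * (?p \<bullet> ?q) + ?D
        \<le> lam k * G (x k)"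
      unfolding w_def by (simp add: inner_diff_right inner_commute algebra_simps)
    then have "G (x (Suc k)) + grad f (x k) \<bullet> ?p - \<beta> k / lam k * (?p \<bullet> ?q) + 1 / lam k * ?D
        \<le> G (x k)"
      using pos by (simp add: field_simps)
    with f_upper[of "x (Suc k)" "x k"]
    have 1: "\<Psi> (x (Suc k)) \<le> \<Psi> (x k) + \<beta> k / lam k * (?p \<bullet> ?q) - (1 / lam k - L) * ?D"
      unfolding \<Psi>_def left_diff_distrib by linarith
    \<comment> \<open>Polarization, dropping the nonpositive term with
      \<open>norm (?p - ?q)\<close>.\<close>
    have "?p \<bullet> ?q \<le> (a (Suc k) + a k) / 2"
      unfolding a_def dot_norm_neg by simp
    then have "\<beta> k / lam k * (?p \<bullet> ?q) \<le> \<beta> k / lam k * ((a (Suc k) + a k) / 2)"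
      using ratio_nonneg by (rule mult_left_mono)
    also have "\<dots> \<le> B * ((a (Suc k) + a k) / 2)"
      using ratio by (rule mult_right_mono) (simp add: a_def)
    finally have 2: "\<beta> k / lam k * (?p \<bullet> ?q) \<le> B * ((a (Suc k) + a k) / 2)" .
    have "M * (\<sigma> / 2 * a (Suc k)) \<le> (1 / lam k - L) * ?D"
      using D_lower[of "x (Suc k)" "x k"] M_le[of k] M_pos \<open>\<sigma> > 0\<close>
      by (intro mult_mono) (auto simp: a_def)
    with 1 2 show ?thesis by (simp add: field_simps)
  qed

  define c where "c = (M * \<sigma> - 2 * B) / 2"
  define V where "V k = \<Psi> (x k) + B / 2 * a k" for k
  have c_pos: "c > 0" using gap by (simp add: c_def)
  have a_nonneg: "a k \<ge> 0" for k by (simp add: a_def)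
  have V_low: "l \<le> V k" if "k \<ge> 1" for k
    using l[OF that] B_nonneg a_nonneg[of k] by (simp add: V_def add_increasing2)
  \<comment> \<open>The summand \<open>a 1\<close> pays for the step from \<open>x 0\<close> to
    \<open>x 1\<close>, which \<open>descent\<close> does not cover.\<close>
  define C where "C = a 1 + (V 1 - l) / c"
  have "C \<ge> 0" unfolding C_def using V_low[of 1] c_pos a_nonneg[of 1] by simp
  moreover have "(MIN k\<in>{1..K}. a k) \<le> C / real K" if "K \<ge> 1" for K
  proof (rule Min_le_of_sum_le[OF _ that])
    \<comment> \<open>For \<open>K = 1\<close> the sum is empty and the bound only says that
      \<open>V 1\<close> is at least \<open>l\<close>.\<close>
    have "(\<Sum>k=Suc 1..K. a k) \<le> (V 1 - l) / c"
      by (rule telescoped_sum_le[OF c_pos _ V_low that])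
        (use descent in \<open>auto simp: V_def c_def\<close>)
    then show "(\<Sum>k=1..K. a k) \<le> C"
      using that by (simp add: C_def sum.atLeast_Suc_atMost)
  qed
  ultimately show ?thesis
    unfolding a_def by blast
qed

end
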